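(* Let $n\ge 3$ and let $G$ be any finite simple connected graph with $n$ vertices and $n$ edges. If $n$ is odd then $N(P_G)\le N(P_{C(n,n)})$, and if $n$ is even then $N(P_G)\le N(P_{C(n,n-1)})$.
   Context: For a finite simple graph $G$ on vertex set $[n]$, the symmetric edge polytope is $P_G=\operatorname{conv}\{\pm(e_i-e_j):\{i,j\}\in E(G)\}\subset\mathbb{R}^n$, where $e_i$ are the standard basis vectors; $N(P)$ denotes the number of facets of a polytope $P$. For graphs $G,H$, a wedge $G\vee H$ is a graph obtained by identifying a vertex of $G$ with a vertex of $H$. $C_m$ denotes the cycle with $m$ edges and $P_\ell$ the path with $\ell$ edges. For $3\le m\le n$, $C(n,m)$ denotes a graph on $n$ vertices obtained by wedging an $m$-cycle $C_m$ with a path with $n-m$ edges (so $C(n,n)=C_n$). *)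

theory Defs
  imports "HOL-Analysis.Analysis"
begin

type_synonym 'v ugraph = "'v set \<times> 'v set set"

abbreviation verts :: "'v ugraph \<Rightarrow> 'v set" where "verts G \<equiv> fst G"
abbreviation edges :: "'v ugraph \<Rightarrow> 'v set set" where "edges G \<equiv> snd G"

definition simple_graph :: "'v ugraph \<Rightarrow> bool" where
  "simple_graph G \<longleftrightarrow> finite (verts G) \<and> (\<forall>e\<in>edges G. e \<subseteq> verts G \<and> card e = 2)"

definition connected_graph :: "'v ugraph \<Rightarrow> bool" where
  "connected_graph G \<longleftrightarrow> verts G \<noteq> {} \<and>
     (\<forall>u\<in>verts G. \<forall>v\<in>verts G. (u, v) \<in> {(a, b). {a, b} \<in> edges G}\<^sup>*)"

definition cycle_graph :: "nat \<Rightarrow> nat ugraph" where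
  "cycle_graph m = ({0..<m}, {{i, (i + 1) mod m} | i. i < m})"

text \<open>The path is indexed by its number of edges, so it has one vertex more.\<close>

definition path_graph :: "nat \<Rightarrow> nat ugraph" where
  "path_graph l = ({0..l}, {{i, i + 1} | i. i < l})"

text \<open>\<open>W\<close> is the union of a copy of \<open>G\<close> and a copy of \<open>H\<close> (the images under the
  injections \<open>f\<close> and \<open>g\<close>) that share exactly one vertex, namely the identified vertex
  \<open>f x = g y\<close>. The vertices \<open>x\<close> and \<open>y\<close> are arbitrary, so this is a relation:
  different choices may give non-isomorphic wedges.\<close>

definition is_wedge :: "'a ugraph \<Rightarrow> 'b ugraph \<Rightarrow> 'c ugraph \<Rightarrow> bool" where
  "is_wedge G H W \<longleftrightarrow>
     (\<exists>f g. \<exists>x\<in>verts G. \<exists>y\<in>verts H.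
        inj_on f (verts G) \<and> inj_on g (verts H) \<and>
        f x = g y \<and> f ` verts G \<inter> g ` verts H = {f x} \<and>
        verts W = f ` verts G \<union> g ` verts H \<and>
        edges W = (\<lambda>e. f ` e) ` edges G \<union> (\<lambda>e. g ` e) ` edges H)"

definition is_cycle_path_wedge :: "nat \<Rightarrow> nat \<Rightarrow> 'v ugraph \<Rightarrow> bool" where
  "is_cycle_path_wedge n m W \<longleftrightarrow>
     3 \<le> m \<and> m \<le> n \<and> is_wedge (cycle_graph m) (path_graph (n - m)) W"

text \<open>Each edge \<open>{i, j}\<close> is met in both orders, which yields both signs of
  \<open>axis i 1 - axis j 1\<close>.\<close>

definition sym_edge_polytope :: "'n::finite ugraph \<Rightarrow> (real ^ 'n) set" where
  "sym_edge_polytope G = convex hull {axis i 1 - axis j 1 | i j. {i, j} \<in> edges G}"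

definition num_facets :: "'a::euclidean_space set \<Rightarrow> nat" where
  "num_facets P = card {F. F facet_of P}"

lemma finite_facets_sym_edge_polytope:
  "finite {F. F facet_of sym_edge_polytope (G :: 'n::finite ugraph)}"
proof -
  have "{axis i (1::real) - axis j 1 | i j. {i, j} \<in> edges G}
        \<subseteq> (\<lambda>(i, j). axis i 1 - axis j 1) ` UNIV"
    by auto
  then have "finite {axis i (1::real) - axis j 1 | i j. {i, j} \<in> edges G}"
    by (rule finite_subset) simp
  then have "polytope (sym_edge_polytope G)"
    unfolding sym_edge_polytope_def polytope_def by blast
  then show ?thesis
    by (rule finite_polytope_facets)
qed

lemma is_cycle_path_wedge_verts:
  fixes W :: "'n::finite ugraph"
  assumes "is_cycle_path_wedge CARD('n) m W"
  shows "verts W = UNIV"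
proof -
  let ?P = "path_graph (CARD('n) - m)"
  have m: "m \<le> CARD('n)" and W: "is_wedge (cycle_graph m) ?P W"
    using assms unfolding is_cycle_path_wedge_def by simp_all
  from W obtain f g x where
        f: "inj_on f (verts (cycle_graph m))" and g: "inj_on g (verts ?P)"
    and I: "f ` verts (cycle_graph m) \<inter> g ` verts ?P = {f x}"
    and V: "verts W = f ` verts (cycle_graph m) \<union> g ` verts ?P"
    unfolding is_wedge_def by (elim exE bexE conjE) (rule that)
  have "card (f ` verts (cycle_graph m)) + card (g ` verts ?P) = card (verts W) + 1"
    unfolding V
    using card_Un_Int[of "f ` verts (cycle_graph m)" "g ` verts ?P"] I by simp
  moreover have "card (f ` verts (cycle_graph m)) = m"
    using card_image[OF f] by (simp add: cycle_graph_def)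
  moreover have "card (g ` verts ?P) = CARD('n) - m + 1"
    using card_image[OF g] by (simp add: path_graph_def)
  ultimately have "card (verts W) = CARD('n)"
    using m by simp
  then show ?thesis
    by (simp add: card_eq_UNIV_imp_eq_UNIV)
qed

lemma is_cycle_path_wedge_exists:
  assumes "3 \<le> m" "m \<le> CARD('n::finite)"
  shows "\<exists>W :: 'n ugraph. is_cycle_path_wedge CARD('n) m W"
proof -
  let ?n = "CARD('n)"
  obtain h :: "nat \<Rightarrow> 'n" where h: "bij_betw h {0..<?n} UNIV"
    using ex_bij_betw_nat_finite[OF finite_class.finite_UNIV] by blast
  then have inj: "inj_on h {0..<?n}" by (rule bij_betw_imp_inj_on)
  define r where "r = (\<lambda>i::nat. if i = 0 then 0 else m - 1 + i)"
  have inj_r: "inj_on r {0..?n - m}"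
    using assms by (auto simp: inj_on_def r_def split: if_splits)
  have r: "r ` {0..?n - m} \<subseteq> {0..<?n}" and C: "{0..<m} \<subseteq> {0..<?n}"
    using assms by (auto simp: r_def)
  have "{0..<m} \<inter> r ` {0..?n - m} = {0}"
    using assms by (auto simp: r_def image_iff split: if_splits)
  then have I: "h ` {0..<m} \<inter> (h \<circ> r) ` {0..?n - m} = {h 0}"
    using inj_on_image_Int[OF inj C r] by (simp add: image_comp)
  let ?W = "(h ` {0..<m} \<union> (h \<circ> r) ` {0..?n - m},
     (\<lambda>e. h ` e) ` edges (cycle_graph m) \<union> (\<lambda>e. (h \<circ> r) ` e) ` edges (path_graph (?n - m)))"
  have "is_wedge (cycle_graph m) (path_graph (?n - m)) ?W"
    unfolding is_wedge_def
  proof (rule exI[of _ h], rule exI[of _ "h \<circ> r"], rule bexI[of _ 0], rule bexI[of _ 0],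
      intro conjI)
    show "inj_on h (verts (cycle_graph m))"
      using inj_on_subset[OF inj C] by (simp add: cycle_graph_def)
    show "inj_on (h \<circ> r) (verts (path_graph (?n - m)))"
      using comp_inj_on[OF inj_r inj_on_subset[OF inj r]] by (simp add: path_graph_def)
    show "h ` verts (cycle_graph m) \<inter> (h \<circ> r) ` verts (path_graph (?n - m)) = {h 0}"
      using I by (simp add: cycle_graph_def path_graph_def)
  qed (use assms in \<open>auto simp: cycle_graph_def path_graph_def r_def\<close>)
  then show ?thesis
    using assms unfolding is_cycle_path_wedge_def by blast
qed

end

theory Submission
  imports Defs
begin

text \<open>
  The polytope is the convex hull of the vectors \<open>\<plusminus> u e\<close>, one pair for each edge \<open>e\<close>. A facet is cut
  out by a functional \<open>c\<close> with \<open>\<bar>c \<bullet> u e\<bar> \<le> 1\<close> whose tight edge vectors still span, and it is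
  determined by the values \<open>c \<bullet> u e\<close>. For a connected graph with as many edges as vertices the edge
  vectors satisfy exactly one linear relation up to scaling; after reorienting edges it reads
  \<open>\<Sum>e\<in>Z. u e = 0\<close>, where \<open>Z\<close> is the edge set of the cycle. So at most one edge is not tight, it lies
  in \<open>Z\<close>, and \<open>c\<close> vanishes on it: the facets correspond to the assignments of \<open>1\<close> and \<open>-1\<close> to the
  edges, with at most one \<open>0\<close>, placed in \<open>Z\<close>, whose sum over \<open>Z\<close> is zero. With \<open>m = card Z\<close> their
  number is \<open>2 ^ (n - m)\<close> times \<open>m choose (m div 2)\<close> for even \<open>m\<close>, and times
  \<open>m * ((m - 1) choose ((m - 1) div 2))\<close> for odd \<open>m\<close>; this is largest for the largest odd \<open>m \<le> n\<close>.
\<close>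

section \<open>Facets of the convex hull of a finite centrally symmetric set\<close>

definition signed_hull :: "('e \<Rightarrow> 'a::euclidean_space) \<Rightarrow> 'e set \<Rightarrow> 'a set" where
  "signed_hull u E = convex hull (u ` E \<union> (\<lambda>e. - u e) ` E)"

text \<open>A face of the hull of a finite set is the hull of some of its points. Here those points
  lie on the hyperplane, so they are among the points of \<open>S\<close> at which \<open>c\<close>
  attains \<open>b\<close>.\<close>

lemma convex_hull_Int_supporting_hyperplane:
  fixes S :: "'a::euclidean_space set"
  assumes "finite S" and le: "\<And>x. x \<in> S \<Longrightarrow> c \<bullet> x \<le> b"
  shows "convex hull S \<inter> {x. c \<bullet> x = b} face_of convex hull S"
    and "convex hull S \<inter> {x. c \<bullet> x = b} = convex hull {x \<in> S. c \<bullet> x = b}"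
proof -
  have hull_le: "c \<bullet> x \<le> b" if "x \<in> convex hull S" for x
  proof -
    have "convex hull S \<subseteq> {x. c \<bullet> x \<le> b}"
      by (rule hull_minimal) (auto simp: le convex_halfspace_le)
    then show ?thesis using that by auto
  qed
  let ?F = "convex hull S \<inter> {x. c \<bullet> x = b}"
  show face: "?F face_of convex hull S"
    by (rule face_of_Int_supporting_hyperplane_le) (auto simp: hull_le)
  obtain S' where S': "S' \<subseteq> S" "?F = convex hull S'"
    using face_of_convex_hull_subset[OF finite_imp_compact[OF \<open>finite S\<close>] face] by blast
  have "S' \<subseteq> ?F" using S'(2) hull_subset by metis
  then have "S' \<subseteq> {x \<in> S. c \<bullet> x = b}" using S'(1) by auto
  then have "?F \<subseteq> convex hull {x \<in> S. c \<bullet> x = b}"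
    using S'(2) hull_mono by metis
  moreover have "convex hull {x \<in> S. c \<bullet> x = b} \<subseteq> ?F"
  proof
    fix x assume x: "x \<in> convex hull {x \<in> S. c \<bullet> x = b}"
    have "convex hull {x \<in> S. c \<bullet> x = b} \<subseteq> {x. c \<bullet> x = b}"
      by (rule hull_minimal) (auto simp: convex_hyperplane)
    moreover have "convex hull {x \<in> S. c \<bullet> x = b} \<subseteq> convex hull S"
      by (rule hull_mono) auto
    ultimately show "x \<in> ?F" using x by auto
  qed
  ultimately show "?F = convex hull {x \<in> S. c \<bullet> x = b}" by blast
qed

text \<open>The hyperplane misses the origin, so adjoining \<open>0\<close> to \<open>T\<close>
  raises the affine dimension by one, and for a set containing \<open>0\<close> affine and linear
  dimension agree.\<close>

lemma aff_dim_in_hyperplane_off_origin: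
  fixes T :: "'a::euclidean_space set"
  assumes "\<And>x. x \<in> T \<Longrightarrow> c \<bullet> x = 1"
  shows "aff_dim T + 1 = int (dim T)"
proof -
  have "affine hull T \<subseteq> {x. c \<bullet> x = 1}"
    by (rule hull_minimal) (auto simp: assms affine_hyperplane)
  then have "0 \<notin> affine hull T" by auto
  then have "aff_dim (insert 0 T) = aff_dim T + 1" by (simp add: aff_dim_insert)
  moreover have "aff_dim (insert 0 T) = int (dim (insert 0 T))"
    by (rule aff_dim_zero) (simp add: hull_inc)
  ultimately show ?thesis by (simp add: dim_insert span_zero)
qed

text \<open>By symmetry \<open>0\<close> is in the hull, so the hull has affine dimension
  \<open>dim S\<close>. A facet is exposed by some \<open>a \<bullet> x = b\<close> with
  \<open>b \<ge> 0\<close>. If \<open>b\<close> were \<open>0\<close>, symmetry would put all of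
  \<open>S\<close> on the hyperplane; hence \<open>b\<close> can be scaled to \<open>1\<close>, and
  having codimension one means that the tight points have the same dimension, thus the same span, as
  \<open>S\<close>.\<close>

lemma facet_of_symmetric_hull_iff:
  fixes S :: "'a::euclidean_space set"
  assumes fin: "finite S" and sym: "\<And>x. x \<in> S \<Longrightarrow> - x \<in> S" and dim: "dim S > 0"
  shows "F facet_of convex hull S \<longleftrightarrow>
    (\<exists>c. (\<forall>x\<in>S. c \<bullet> x \<le> 1) \<and> span {x \<in> S. c \<bullet> x = 1} = span S \<and>
         F = convex hull S \<inter> {x. c \<bullet> x = 1})"
proof -
  obtain x where "x \<in> S" using dim by fastforce
  have "(1/2) *\<^sub>R x + (1/2) *\<^sub>R (- x) \<in> convex hull S"
    by (rule convexD[OF convex_convex_hull]) (auto simp: hull_inc \<open>x \<in> S\<close> sym)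
  then have zero: "0 \<in> convex hull S" by simp
  then have "0 \<in> affine hull S" using convex_hull_subset_affine_hull by blast
  then have affS: "aff_dim (convex hull S) = int (dim S)"
    by (simp add: aff_dim_convex_hull aff_dim_zero)
  have affF: "aff_dim (convex hull S \<inter> {x. c \<bullet> x = 1}) + 1 = int (dim {x \<in> S. c \<bullet> x = 1})"
    if "\<forall>x\<in>S. c \<bullet> x \<le> 1" for c
    using that aff_dim_in_hyperplane_off_origin[of "{x \<in> S. c \<bullet> x = 1}" c]
    by (simp add: convex_hull_Int_supporting_hyperplane(2)[OF fin] aff_dim_convex_hull)
  show ?thesis
  proof
    assume F: "F facet_of convex hull S"
    then have face: "F face_of convex hull S" and "F \<noteq> {}"
      and aff: "aff_dim F = aff_dim (convex hull S) - 1"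
      by (auto simp: facet_of_def)
    have "F exposed_face_of convex hull S"
      using face fin by (simp add: exposed_face_of_polyhedron polyhedron_convex_hull)
    then obtain a b where ab: "convex hull S \<subseteq> {x. a \<bullet> x \<le> b}"
      "F = convex hull S \<inter> {x. a \<bullet> x = b}"
      unfolding exposed_face_of_def by blast
    have b0: "b \<ge> 0" using zero ab(1) by auto
    have leS: "a \<bullet> x \<le> b" if "x \<in> S" for x
      using ab(1) hull_inc[OF that, of convex] by auto
    have "b \<noteq> 0"
    proof
      assume "b = 0"
      then have "a \<bullet> x = b" if "x \<in> S" for x
        using leS[OF that] leS[OF sym[OF that]] by simp
      then have "convex hull S \<subseteq> {x. a \<bullet> x = b}"
        by (intro hull_minimal) (auto simp: convex_hyperplane)
      then have "F = convex hull S" using ab(2) by blast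
      then show False using aff by simp
    qed
    then have b: "b > 0" using b0 by simp
    define c where "c = a /\<^sub>R b"
    have c_le: "\<forall>x\<in>S. c \<bullet> x \<le> 1"
      using leS b by (auto simp: c_def field_simps)
    have Fc: "F = convex hull S \<inter> {x. c \<bullet> x = 1}"
      using ab(2) b by (auto simp: c_def field_simps)
    have "dim {x \<in> S. c \<bullet> x = 1} = dim S"
      using affF[OF c_le] aff affS Fc by simp
    then have "span {x \<in> S. c \<bullet> x = 1} = span S"
      by (intro dim_eq_span) auto
    then show "\<exists>c. (\<forall>x\<in>S. c \<bullet> x \<le> 1) \<and> span {x \<in> S. c \<bullet> x = 1} = span S \<and>
         F = convex hull S \<inter> {x. c \<bullet> x = 1}"
      using c_le Fc by blast
  next
    assume "\<exists>c. (\<forall>x\<in>S. c \<bullet> x \<le> 1) \<and> span {x \<in> S. c \<bullet> x = 1} = span S \<and>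
         F = convex hull S \<inter> {x. c \<bullet> x = 1}"
    then obtain c where c_le: "\<forall>x\<in>S. c \<bullet> x \<le> 1" and sp: "span {x \<in> S. c \<bullet> x = 1} = span S"
      and Fc: "F = convex hull S \<inter> {x. c \<bullet> x = 1}" by blast
    have "dim {x \<in> S. c \<bullet> x = 1} = dim S" using sp by (metis dim_span)
    then have aff: "aff_dim F = aff_dim (convex hull S) - 1"
      using affF[OF c_le] Fc affS by simp
    moreover have "F face_of convex hull S"
      unfolding Fc by (rule convex_hull_Int_supporting_hyperplane(1)) (use fin c_le in auto)
    moreover have "F \<noteq> {}"
    proof
      assume "F = {}"
      then have "int (dim S) = 0" using aff affS by (simp del: dim_eq_0)
      then show False using dim by linarith
    qed
    ultimately show "F facet_of convex hull S" by (simp add: facet_of_def)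
  qed
qed

lemma span_signed_image:
  fixes u :: "'e \<Rightarrow> 'a::real_vector"
  assumes "\<And>x. x \<in> S \<Longrightarrow> \<exists>e\<in>T. x = u e \<or> x = - u e"
    and "\<And>e. e \<in> T \<Longrightarrow> u e \<in> S \<or> - u e \<in> S"
  shows "span S = span (u ` T)"
proof (rule span_eq[THEN iffD2], intro conjI subsetI)
  fix x assume "x \<in> S"
  then show "x \<in> span (u ` T)"
    using assms(1)[of x] by (auto intro: span_base span_neg)
next
  fix x assume "x \<in> u ` T"
  then obtain e where e: "e \<in> T" "x = u e" by blast
  from assms(2)[OF e(1)] show "x \<in> span S"
  proof
    assume "- u e \<in> S"
    then have "- (- u e) \<in> span S" by (intro span_neg span_base)
    then show ?thesis using e(2) by simp
  qed (simp add: e(2) span_base)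
qed

lemma facet_of_signed_hull_iff:
  fixes u :: "'e \<Rightarrow> 'a::euclidean_space"
  assumes fin: "finite E" and dim: "dim (u ` E) > 0"
  shows "F facet_of signed_hull u E \<longleftrightarrow>
    (\<exists>c. (\<forall>e\<in>E. \<bar>c \<bullet> u e\<bar> \<le> 1) \<and> span (u ` {e \<in> E. \<bar>c \<bullet> u e\<bar> = 1}) = span (u ` E) \<and>
         F = signed_hull u E \<inter> {x. c \<bullet> x = 1})"
proof -
  let ?S = "u ` E \<union> (\<lambda>e. - u e) ` E"
  have spS: "span ?S = span (u ` E)" by (rule span_signed_image) auto
  have "dim ?S > 0" using dim spS by (metis dim_span)
  then have *: "F facet_of convex hull ?S \<longleftrightarrow>
    (\<exists>c. (\<forall>x\<in>?S. c \<bullet> x \<le> 1) \<and> span {x \<in> ?S. c \<bullet> x = 1} = span ?S \<and>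
         F = convex hull ?S \<inter> {x. c \<bullet> x = 1})"
    by (intro facet_of_symmetric_hull_iff) (use fin in auto)
  have "span {x \<in> ?S. c \<bullet> x = 1} = span (u ` {e \<in> E. \<bar>c \<bullet> u e\<bar> = 1})" for c
    by (rule span_signed_image) (auto simp: abs_if split: if_splits)
  moreover have "(\<forall>x\<in>?S. c \<bullet> x \<le> 1) \<longleftrightarrow> (\<forall>e\<in>E. \<bar>c \<bullet> u e\<bar> \<le> 1)" for c
    by (simp add: ball_Un abs_le_iff ball_conj_distrib minus_le_iff)
  ultimately show ?thesis using * spS by (simp add: signed_hull_def)
qed

section \<open>Vector families with one linear relation\<close>

lemma span_image_remove_circuit_element:
  fixes u :: "'e \<Rightarrow> 'a::euclidean_space"
  assumes "finite Z" "Z \<subseteq> T" "z \<in> Z" "(\<Sum>e\<in>Z. u e) = 0"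
  shows "span (u ` (T - {z})) = span (u ` T)"
proof (rule span_eq[THEN iffD2], intro conjI subsetI)
  fix x assume "x \<in> u ` T"
  then obtain e where e: "e \<in> T" "x = u e" by auto
  have "u z + (\<Sum>e\<in>Z - {z}. u e) = 0"
    using assms by (simp add: sum.remove)
  then have uz: "u z = - (\<Sum>e\<in>Z - {z}. u e)" by (simp add: eq_neg_iff_add_eq_0)
  have "u z \<in> span (u ` (T - {z}))"
    unfolding uz using assms(2) by (intro span_neg span_sum span_base) auto
  then show "x \<in> span (u ` (T - {z}))"
    using e by (cases "e = z") (auto intro: span_base)
qed (auto intro: span_base)

lemma span_image_cocircuit:
  fixes u :: "'e \<Rightarrow> 'a::euclidean_space"
  assumes fin: "finite E" and Z: "Z \<subseteq> E" "Z \<noteq> {}" "(\<Sum>e\<in>Z. u e) = 0"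
    and card: "card E \<le> dim (u ` E) + 1"
    and T: "T \<subseteq> E" "span (u ` T) = span (u ` E)"
  shows "card (E - T) \<le> 1" and "E - T \<subseteq> Z"
proof -
  have finT: "finite T" using fin T(1) finite_subset by blast
  have dimT: "dim (u ` T) = dim (u ` E)" using T(2) by (metis dim_span)
  have "dim (u ` T) \<le> card T"
    using dim_le_card'[of "u ` T"] card_image_le[OF finT, of u] finT by simp
  then show le: "card (E - T) \<le> 1"
    using card dimT T(1) finT by (simp add: card_Diff_subset)
  show "E - T \<subseteq> Z"
  proof (rule ccontr)
    assume "\<not> E - T \<subseteq> Z"
    then obtain y where y: "y \<in> E - T" "y \<notin> Z" by blast
    have "Z \<subseteq> T"
    proof
      fix e assume "e \<in> Z"
      then show "e \<in> T"
        using y Z(1) le fin card_le_Suc0_iff_eq[of "E - T"] 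
        by (metis Diff_iff One_nat_def finite_Diff subsetD)
    qed
    obtain z where z: "z \<in> Z" using Z(2) by blast
    have "span (u ` (T - {z})) = span (u ` T)"
      using Z z \<open>Z \<subseteq> T\<close> finT by (intro span_image_remove_circuit_element) (auto intro: finite_subset)
    then have "dim (u ` E) = dim (u ` (T - {z}))" using T(2) by (metis dim_span)
    also have "\<dots> \<le> card (T - {z})"
      using dim_le_card'[of "u ` (T - {z})"] card_image_le[of "T - {z}" u] finT by simp
    also have "\<dots> < card T" using z \<open>Z \<subseteq> T\<close> finT by (intro psubset_card_mono) auto
    finally have "card E \<le> card T" using card by simp
    moreover have "card T < card E"
      using y T(1) fin by (intro psubset_card_mono) auto
    ultimately show False by simp
  qed
qed

text \<open>Dropping one \<open>z \<in> Z\<close> leaves a basis of the span, on which the values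
  may be prescribed freely; the relation over \<open>Z\<close> and the vanishing sum of
  \<open>s\<close> then force the right value at \<open>z\<close>.\<close>

lemma circuit_functional_extension:
  fixes u :: "'e \<Rightarrow> 'a::euclidean_space"
  assumes fin: "finite E" and Z: "Z \<subseteq> E" "Z \<noteq> {}" "(\<Sum>e\<in>Z. u e) = 0"
    and card: "card E \<le> dim (u ` E) + 1" and s: "(\<Sum>e\<in>Z. s e) = (0::real)"
  shows "\<exists>c. \<forall>e\<in>E. c \<bullet> u e = s e"
proof -
  obtain z where z: "z \<in> Z" using Z(2) by blast
  have finZ: "finite Z" using fin Z(1) finite_subset by blast
  let ?E = "E - {z}"
  have sp: "span (u ` ?E) = span (u ` E)"
    using Z z finZ by (intro span_image_remove_circuit_element) auto
  have dim: "dim (u ` ?E) = dim (u ` E)" using sp by (metis dim_span)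
  have "card ?E \<le> dim (u ` ?E)" using card dim z Z(1) fin by (auto simp: card_Diff_singleton)
  moreover have "card (u ` ?E) \<le> card ?E" using fin by (intro card_image_le) auto
  moreover have "dim (u ` ?E) \<le> card (u ` ?E)" using fin by (intro dim_le_card') auto
  ultimately have eq: "card (u ` ?E) = card ?E" "card (u ` ?E) = dim (u ` ?E)" by auto
  have inj: "inj_on u ?E" using eq(1) fin by (intro eq_card_imp_inj_on) auto
  have "independent (u ` ?E)"
    using eq(2) fin by (intro card_le_dim_spanning[of _ "u ` ?E"]) (auto intro: span_base)
  \<comment> \<open>The extension theorem prescribes values on vectors, so \<open>s\<close> is
    transported along the inverse of \<open>u\<close>; the adjoint then represents \<open>g\<close>
    as an inner product.\<close>
  then obtain g :: "'a \<Rightarrow> real" where g: "linear g" "\<forall>x\<in>u ` ?E. g x = s (inv_into ?E u x)"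
    using linear_independent_extend[of "u ` ?E" "\<lambda>x. s (inv_into ?E u x)"] by auto
  define c where "c = adjoint g 1"
  have "c \<bullet> x = g x" for x
    using adjoint_works[OF g(1), of x 1] by (simp add: c_def inner_commute)
  then have c: "c \<bullet> u e = s e" if "e \<in> ?E" for e
    using g(2) that inv_into_f_f[OF inj that] by simp
  have "c \<bullet> (\<Sum>e\<in>Z. u e) = (\<Sum>e\<in>Z. s e)" using Z(3) s by simp
  then have "c \<bullet> u z + (\<Sum>e\<in>Z - {z}. c \<bullet> u e) = s z + (\<Sum>e\<in>Z - {z}. s e)"
    by (simp add: inner_sum_right inner_add_right sum.remove[OF finZ z])
  moreover have "(\<Sum>e\<in>Z - {z}. c \<bullet> u e) = (\<Sum>e\<in>Z - {z}. s e)"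
    using c Z(1) by (intro sum.cong) auto
  ultimately have "c \<bullet> u z = s z" by simp
  then show ?thesis using c by blast
qed

section \<open>Counting the sign assignments\<close>

text \<open>A value in \<open>{1, 0, -1}\<close> is twice the indicator of \<open>1\<close> plus the
  indicator of \<open>0\<close>, minus one. This turns the vanishing of the sum into the cardinality
  equation of \<open>circuit_signs\<close>.\<close>

lemma sum_signs:
  fixes s :: "'e \<Rightarrow> real"
  assumes "finite Z" "\<And>e. e \<in> Z \<Longrightarrow> s e \<in> {1, 0, -1}"
  shows "(\<Sum>e\<in>Z. s e) = 2 * card {e \<in> Z. s e = 1} + card {e \<in> Z. s e = 0} - real (card Z)"
proof -
  have "(\<Sum>e\<in>Z. s e) = (\<Sum>e\<in>Z. 2 * of_bool (s e = 1) + of_bool (s e = 0) - 1)"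
    using assms(2) by (intro sum.cong) auto
  also have "\<dots> = 2 * card {e \<in> Z. s e = 1} + card {e \<in> Z. s e = 0} - real (card Z)"
    using assms(1) by (simp add: sum.distrib sum_subtractf sum_of_bool_eq Int_def
        flip: sum_distrib_left)
  finally show ?thesis .
qed

text \<open>A pair \<open>(A, B)\<close> encodes the assignment with value \<open>1\<close> on \<open>A\<close>, \<open>0\<close> on \<open>B\<close> and \<open>-1\<close> elsewhere.\<close>

definition circuit_signs :: "'e set \<Rightarrow> 'e set \<Rightarrow> ('e set \<times> 'e set) set" where
  "circuit_signs E Z = {(A, B). A \<subseteq> E \<and> B \<subseteq> Z \<and> A \<inter> B = {} \<and> card B \<le> 1 \<and>
     2 * card (A \<inter> Z) + card B = card Z}"

definition cycle_facets :: "nat \<Rightarrow> nat" where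
  "cycle_facets m = (if even m then m choose (m div 2) else m * ((m - 1) choose ((m - 1) div 2)))"

text \<open>Parity decides \<open>B\<close>: it is empty when \<open>card Z\<close> is even and a
  singleton when \<open>card Z\<close> is odd. What remains is to choose half of \<open>Z\<close>,
  or half of \<open>Z\<close> without the zero, and an arbitrary subset of
  \<open>E - Z\<close>.\<close>

lemma card_circuit_signs:
  assumes fin: "finite E" and Z: "Z \<subseteq> E"
  shows "card (circuit_signs E Z) = cycle_facets (card Z) * 2 ^ (card E - card Z)"
proof -
  have finZ: "finite Z" using fin Z finite_subset by blast
  let ?Y = "Pow (E - Z)"
  have cardY: "card ?Y = 2 ^ (card E - card Z)"
    using fin finZ Z by (simp add: card_Pow card_Diff_subset)
  show ?thesis
  proof (cases "even (card Z)")
    case True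
    let ?X = "{A. A \<subseteq> Z \<and> card A = card Z div 2}"
    \<comment> \<open>\<open>?f\<close> merges the parts of \<open>A\<close> inside and outside
      \<open>Z\<close>, and \<open>?g\<close> separates them again. In the odd case below the pair
      also carries the position \<open>z\<close> of the zero.\<close>
    let ?f = "\<lambda>(A, A'). (A \<union> A', {})"
    let ?g = "\<lambda>(A, B). (A \<inter> Z, A - Z)"
    have "bij_betw ?f (?X \<times> ?Y) (circuit_signs E Z)"
    proof (rule bij_betw_byWitness[where f' = ?g])
      show "?f ` (?X \<times> ?Y) \<subseteq> circuit_signs E Z"
      proof clarify
        fix A A' assume A: "A \<subseteq> Z" "card A = card Z div 2" "A' \<subseteq> E - Z"
        have "(A \<union> A') \<inter> Z = A" using A by blast
        then show "(A \<union> A', {}) \<in> circuit_signs E Z"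
          using A Z True by (auto simp: circuit_signs_def)
      qed
      have B: "B = {} \<and> card (A \<inter> Z) = card Z div 2" if "(A, B) \<in> circuit_signs E Z" for A B
      proof -
        have B: "card B \<le> 1" "2 * card (A \<inter> Z) + card B = card Z" "finite B"
          using that finZ by (auto simp: circuit_signs_def intro: finite_subset)
        have "card B = 0" using B(1,2) True by presburger
        then show ?thesis using B by auto
      qed
      show "\<forall>p\<in>circuit_signs E Z. ?f (?g p) = p"
        using B by (auto simp: Int_Diff_Un)
      show "?g ` circuit_signs E Z \<subseteq> ?X \<times> ?Y"
        using B by (fastforce simp: circuit_signs_def)
    qed auto
    then have "card (circuit_signs E Z) = card (?X \<times> ?Y)" by (simp add: bij_betw_same_card)
    then show ?thesis using True cardY finZ
      by (simp add: card_cartesian_product n_subsets cycle_facets_def)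
  next
    case False
    let ?X = "SIGMA z:Z. {A. A \<subseteq> Z - {z} \<and> card A = (card Z - 1) div 2}"
    let ?f = "\<lambda>((z, A), A'). (A \<union> A', {z})"
    let ?g = "\<lambda>(A, B). ((the_elem B, A \<inter> Z), A - Z)"
    have "bij_betw ?f (?X \<times> ?Y) (circuit_signs E Z)"
    proof (rule bij_betw_byWitness[where f' = ?g])
      show "?f ` (?X \<times> ?Y) \<subseteq> circuit_signs E Z"
      proof clarify
        fix z A A' assume A: "z \<in> Z" "A \<subseteq> Z - {z}" "card A = (card Z - 1) div 2" "A' \<subseteq> E - Z"
        have "(A \<union> A') \<inter> Z = A" using A by blast
        moreover have "2 * ((card Z - 1) div 2) + 1 = card Z" using False by presburger
        ultimately show "(A \<union> A', {z}) \<in> circuit_signs E Z"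
          using A Z by (auto simp: circuit_signs_def)
      qed
      have B: "\<exists>z. B = {z} \<and> card (A \<inter> Z) = (card Z - 1) div 2"
        if "(A, B) \<in> circuit_signs E Z" for A B
      proof -
        have B: "card B \<le> 1" "2 * card (A \<inter> Z) + card B = card Z"
          using that by (auto simp: circuit_signs_def)
        have "card B = 1" using B False by presburger
        moreover from this have "card (A \<inter> Z) = (card Z - 1) div 2" using B by presburger
        ultimately show ?thesis by (auto simp: card_1_singleton_iff)
      qed
      show "\<forall>p\<in>circuit_signs E Z. ?f (?g p) = p"
        using B by (force simp: Int_Diff_Un)
      show "?g ` circuit_signs E Z \<subseteq> ?X \<times> ?Y"
      proof (intro image_subsetI)
        fix p assume p: "p \<in> circuit_signs E Z"
        obtain A B where AB: "p = (A, B)" by (cases p)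
        then obtain z where "B = {z}" "card (A \<inter> Z) = (card Z - 1) div 2" using B p by blast
        then show "?g p \<in> ?X \<times> ?Y"
          using p AB by (auto simp: circuit_signs_def)
      qed
    qed auto
    then have "card (circuit_signs E Z) = card (?X \<times> ?Y)" by (simp add: bij_betw_same_card)
    also have "\<dots> = card ?X * card ?Y" by (rule card_cartesian_product)
    also have "card ?X = (\<Sum>z\<in>Z. (card Z - 1) choose ((card Z - 1) div 2))"
      using finZ by (simp add: card_SigmaI n_subsets card_Diff_singleton)
    finally show ?thesis using False cardY by (simp add: cycle_facets_def)
  qed
qed

section \<open>The facet count for a family with one circuit\<close>

theorem num_facets_signed_hull_circuit:
  fixes u :: "'e \<Rightarrow> 'a::euclidean_space"
  assumes fin: "finite E" and Z: "Z \<subseteq> E" "Z \<noteq> {}" "(\<Sum>e\<in>Z. u e) = 0"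
    and card: "card E \<le> dim (u ` E) + 1" and dim: "dim (u ` E) > 0"
  shows "num_facets (signed_hull u E) = cycle_facets (card Z) * 2 ^ (card E - card Z)"
proof -
  have finZ: "finite Z" using fin Z(1) finite_subset by blast
  let ?P = "signed_hull u E"
  let ?tight = "\<lambda>c. {e \<in> E. \<bar>c \<bullet> u e\<bar> = 1}"
  \<comment> \<open>\<open>supp c F\<close> says that \<open>c\<close> cuts out the facet
    \<open>F\<close>. Such a \<open>c\<close> is unique only up to vectors orthogonal to all
    \<open>u e\<close>, so all that follows goes through the values
    \<open>c \<bullet> u e\<close>.\<close>
  define supp where "supp c F \<longleftrightarrow> (\<forall>e\<in>E. \<bar>c \<bullet> u e\<bar> \<le> 1) \<and>
      span (u ` ?tight c) = span (u ` E) \<and> F = ?P \<inter> {x. c \<bullet> x = 1}" for c F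
  define signs where "signs c = ({e \<in> E. c \<bullet> u e = 1}, {e \<in> E. c \<bullet> u e = 0})" for c
  have facet: "F facet_of ?P \<longleftrightarrow> (\<exists>c. supp c F)" for F
    unfolding supp_def by (rule facet_of_signed_hull_iff[OF fin dim])
  have sumZ: "(\<Sum>e\<in>Z. c \<bullet> u e) = 0" for c
    using Z(3) by (metis inner_sum_right inner_zero_right)
  have ternary: "c \<bullet> u e \<in> {1, 0, -1}" "E - ?tight c = {e \<in> E. c \<bullet> u e = 0}"
    if c: "supp c F" and "e \<in> E" for c F e
  proof -
    have T: "card (E - ?tight c) \<le> 1" "E - ?tight c \<subseteq> Z"
      using span_image_cocircuit[OF fin Z card, of "?tight c"] c by (auto simp: supp_def)
    \<comment> \<open>All other members of \<open>Z\<close> are tight, with value \<open>1\<close>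
      or \<open>-1\<close>, so the relation over \<open>Z\<close> makes the value at
      \<open>y\<close> an integer. Its absolute value is below \<open>1\<close>.\<close>
    have zero: "c \<bullet> u y = 0" if y: "y \<in> E - ?tight c" for y
    proof -
      have "y \<in> Z" using y T(2) by blast
      have "c \<bullet> u e \<in> \<int>" if "e \<in> Z - {y}" for e
      proof -
        have "e \<in> ?tight c"
          using that y Z(1) T(1) fin card_le_Suc0_iff_eq[of "E - ?tight c"] by auto
        then have "c \<bullet> u e = 1 \<or> c \<bullet> u e = -1" by auto
        then show ?thesis by auto
      qed
      then have "(\<Sum>e\<in>Z - {y}. c \<bullet> u e) \<in> \<int>" by (intro Ints_sum)
      moreover have "c \<bullet> u y = - (\<Sum>e\<in>Z - {y}. c \<bullet> u e)"
        using sumZ[of c] \<open>y \<in> Z\<close> finZ by (simp add: sum.remove)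
      ultimately have "c \<bullet> u y \<in> \<int>" by simp
      moreover have "\<bar>c \<bullet> u y\<bar> < 1" using y c by (force simp: supp_def)
      ultimately show ?thesis using Ints_nonzero_abs_less1 by blast
    qed
    show "E - ?tight c = {e \<in> E. c \<bullet> u e = 0}" using zero by auto
    show "c \<bullet> u e \<in> {1, 0, -1}" using zero[of e] \<open>e \<in> E\<close> by fastforce
  qed
  have signs_in: "signs c \<in> circuit_signs E Z" if c: "supp c F" for c F
  proof -
    have eq: "E - ?tight c = {e \<in> E. c \<bullet> u e = 0}"
      using ternary(2)[OF c] Z by blast
    have B: "card {e \<in> E. c \<bullet> u e = 0} \<le> 1" "{e \<in> E. c \<bullet> u e = 0} \<subseteq> Z"
      using span_image_cocircuit[OF fin Z card, of "?tight c"] c eq by (auto simp: supp_def)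
    have "real (2 * card {e \<in> Z. c \<bullet> u e = 1} + card {e \<in> Z. c \<bullet> u e = 0}) = real (card Z)"
      using sum_signs[OF finZ, of "\<lambda>e. c \<bullet> u e"] ternary(1)[OF c] Z(1) sumZ[of c] by auto
    then have "2 * card {e \<in> Z. c \<bullet> u e = 1} + card {e \<in> Z. c \<bullet> u e = 0} = card Z"
      by linarith
    moreover have "{e \<in> E. c \<bullet> u e = 1} \<inter> Z = {e \<in> Z. c \<bullet> u e = 1}"
      "{e \<in> Z. c \<bullet> u e = 0} = {e \<in> E. c \<bullet> u e = 0}" using Z(1) B(2) by auto
    ultimately show ?thesis using B by (auto simp: signs_def circuit_signs_def)
  qed
  \<comment> \<open>Equal signs give equal values on all \<open>u e\<close>, hence on the whole
    polytope. Conversely, a facet contains each tight vector or its negative, so two functionals for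
    it agree on the tight vectors, and these span everything.\<close>
  have agree: "F = F' \<longleftrightarrow> signs c = signs c'" if c: "supp c F" and c': "supp c' F'" for c c' F F'
  proof
    assume eq: "signs c = signs c'"
    have "c \<bullet> u e = c' \<bullet> u e" if "e \<in> E" for e
    proof -
      have "(c \<bullet> u e = 1) = (c' \<bullet> u e = 1)" "(c \<bullet> u e = 0) = (c' \<bullet> u e = 0)"
        using eq that unfolding signs_def by blast+
      then show ?thesis using ternary(1)[OF c that] ternary(1)[OF c' that] by auto
    qed
    then have "?P \<subseteq> {x. (c - c') \<bullet> x = 0}"
      unfolding signed_hull_def
      by (intro hull_minimal convex_hyperplane) (auto simp: inner_diff_left)
    then have "?P \<inter> {x. c \<bullet> x = 1} = ?P \<inter> {x. c' \<bullet> x = 1}"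
      by (auto simp: inner_diff_left)
    then show "F = F'" using c c' by (simp add: supp_def)
  next
    assume eq: "F = F'"
    have tight: "c \<bullet> u e = c' \<bullet> u e" if e: "e \<in> ?tight c" for e
    proof -
      obtain v where v: "v = u e \<or> v = - u e" "c \<bullet> v = 1"
        using e by (cases "c \<bullet> u e = 1") (auto intro: that[of "- u e"])
      have "v \<in> ?P" unfolding signed_hull_def
        using v(1) e by (intro hull_inc) auto
      then have "v \<in> F'" using v(2) c eq by (simp add: supp_def)
      then have "c' \<bullet> v = 1" using c' by (simp add: supp_def)
      then show ?thesis using v by auto
    qed
    have "(c - c') \<bullet> u e = 0" if "e \<in> ?tight c" for e
      using tight[OF that] by (simp add: inner_diff_left)
    then have "span (u ` ?tight c) \<subseteq> {x. (c - c') \<bullet> x = 0}"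
      by (intro span_minimal subspace_hyperplane image_subsetI CollectI)
    moreover have "u e \<in> span (u ` ?tight c)" if "e \<in> E" for e
      using that c by (auto simp: supp_def intro: span_base)
    ultimately have "(c - c') \<bullet> u e = 0" if "e \<in> E" for e
      using that by blast
    then have "c \<bullet> u e = c' \<bullet> u e" if "e \<in> E" for e
      using that by (simp add: inner_diff_left)
    then show "signs c = signs c'" by (auto simp: signs_def)
  qed
  have onto: "\<exists>c F. supp c F \<and> signs c = (A, B)" if AB: "(A, B) \<in> circuit_signs E Z" for A B
  proof -
    have A: "A \<subseteq> E" "B \<subseteq> Z" "A \<inter> B = {}" "card B \<le> 1" "2 * card (A \<inter> Z) + card B = card Z"
      using AB by (auto simp: circuit_signs_def)
    define s :: "'e \<Rightarrow> real" where "s e = (if e \<in> A then 1 else if e \<in> B then 0 else -1)" for e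
    have "{e \<in> Z. s e = 1} = A \<inter> Z" "{e \<in> Z. s e = 0} = B"
      using A by (auto simp: s_def)
    then have "(\<Sum>e\<in>Z. s e) = real (2 * card (A \<inter> Z) + card B) - real (card Z)"
      using sum_signs[OF finZ, of s] by (auto simp: s_def)
    then have "(\<Sum>e\<in>Z. s e) = 0" using A(5) by simp
    then obtain c where c: "\<forall>e\<in>E. c \<bullet> u e = s e"
      using circuit_functional_extension[OF fin Z card] by blast
    have "\<bar>s e\<bar> = 1 \<longleftrightarrow> e \<notin> B" for e using A(3) by (auto simp: s_def)
    then have tight: "?tight c = E - B" using c by auto
    \<comment> \<open>The zero sits in \<open>Z\<close>, so its vector is a combination of the
      others there and the tight vectors still span.\<close>
    have "span (u ` (E - B)) = span (u ` E)"
    proof (cases "B = {}")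
      case False
      have "finite B" using A(2) finZ finite_subset by blast
      then obtain z where z: "B = {z}"
        using False A(4) by (metis card_0_eq card_1_singletonE le_antisym less_one not_le)
      then show ?thesis
        using span_image_remove_circuit_element[OF finZ Z(1) _ Z(3), of z] A(2) by auto
    qed simp
    then have "supp c (?P \<inter> {x. c \<bullet> x = 1})"
      using c tight by (auto simp: supp_def s_def)
    moreover have "s e = 1 \<longleftrightarrow> e \<in> A" "s e = 0 \<longleftrightarrow> e \<in> B" for e
      using A(3) by (auto simp: s_def)
    then have "signs c = (A, B)"
      using c A(1,2) Z(1) by (auto simp: signs_def)
    ultimately show ?thesis by blast
  qed
  \<comment> \<open>By \<open>agree\<close>, the signs do not depend on the functional chosen
    here.\<close>
  define \<Phi> where "\<Phi> F = signs (SOME c. supp c F)" for F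
  have some: "supp (SOME c. supp c F) F" if "F facet_of ?P" for F
    using that facet someI_ex[of "\<lambda>c. supp c F"] by blast
  have "bij_betw \<Phi> {F. F facet_of ?P} (circuit_signs E Z)"
    unfolding bij_betw_def
  proof (intro conjI inj_onI)
    fix F F' assume "F \<in> {F. F facet_of ?P}" "F' \<in> {F. F facet_of ?P}" "\<Phi> F = \<Phi> F'"
    then show "F = F'" using agree[OF some some] by (auto simp: \<Phi>_def)
  next
    show "\<Phi> ` {F. F facet_of ?P} = circuit_signs E Z"
    proof (intro equalityI subsetI)
      fix p assume "p \<in> \<Phi> ` {F. F facet_of ?P}"
      then show "p \<in> circuit_signs E Z" using signs_in some by (auto simp: \<Phi>_def)
    next
      fix p assume "p \<in> circuit_signs E Z"
      then obtain c F where cF: "supp c F" "signs c = p" using onto by (metis surj_pair)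
      then have "F facet_of ?P" using facet by blast
      moreover have "\<Phi> F = p" using agree[OF some[OF calculation] cF(1)] cF(2) by (simp add: \<Phi>_def)
      ultimately show "p \<in> \<Phi> ` {F. F facet_of ?P}" by blast
    qed
  qed
  then have "num_facets ?P = card (circuit_signs E Z)"
    unfolding num_facets_def by (rule bij_betw_same_card)
  then show ?thesis using card_circuit_signs[OF fin Z(1)] by simp
qed


section \<open>Edge vectors of a graph\<close>

text \<open>One direction is fixed per edge; the opposite one reappears as \<open>- u e\<close> in
  \<open>signed_hull\<close>. Leaving \<open>u\<close> variable makes it possible to reorient edges
  later.\<close>

definition oriented :: "('n::finite set \<Rightarrow> real ^ 'n) \<Rightarrow> 'n set set \<Rightarrow> bool" where
  "oriented u E \<longleftrightarrow> (\<forall>e\<in>E. \<exists>i j. i \<noteq> j \<and> e = {i, j} \<and> u e = axis i 1 - axis j 1)"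

lemma orientedE:
  assumes "oriented u E" "e \<in> E"
  obtains i j where "i \<noteq> j" "e = {i, j}" "u e = axis i 1 - axis j 1"
  using bspec[OF assms(1)[unfolded oriented_def] assms(2)] that by blast

lemma oriented_subset: "F \<subseteq> E \<Longrightarrow> oriented u E \<Longrightarrow> oriented u F"
  unfolding oriented_def by (rule ballI) (erule bspec, erule (1) subsetD)

lemma oriented_exists:
  fixes E :: "'n::finite set set"
  assumes "\<And>e. e \<in> E \<Longrightarrow> card e = 2"
  shows "\<exists>u. oriented u E"
proof -
  have "\<forall>e\<in>E. \<exists>v :: real ^ 'n. \<exists>i j. i \<noteq> j \<and> e = {i, j} \<and> v = axis i 1 - axis j 1"
  proof
    fix e assume "e \<in> E"
    then obtain i j where "e = {i, j}" "i \<noteq> j" using assms by (metis card_2_iff)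
    then show "\<exists>v :: real ^ 'n. \<exists>i j. i \<noteq> j \<and> e = {i, j} \<and> v = axis i 1 - axis j 1" by blast
  qed
  then show ?thesis unfolding oriented_def by (rule bchoice)
qed

lemma oriented_doubleton:
  assumes "oriented u E" "{i, j} \<in> E"
  shows "i \<noteq> j" "u {i, j} = axis i 1 - axis j 1 \<or> u {i, j} = axis j 1 - axis i 1"
proof -
  obtain i' j' where "i' \<noteq> j'" "{i, j} = {i', j'}" "u {i, j} = axis i' 1 - axis j' 1"
    using assms by (rule orientedE)
  then show "i \<noteq> j" "u {i, j} = axis i 1 - axis j 1 \<or> u {i, j} = axis j 1 - axis i 1"
    by (auto simp: doubleton_eq_iff)
qed

text \<open>An edge is recovered from its vector as the set of nonzero coordinates.\<close>

lemma oriented_inj_on: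
  assumes "oriented u E"
  shows "inj_on u E"
proof (rule inj_on_inverseI)
  fix e assume "e \<in> E"
  then obtain i j where "i \<noteq> j" "e = {i, j}" "u e = axis i 1 - axis j 1"
    using assms by (elim orientedE)
  then show "{k. u e $ k \<noteq> 0} = e" by (auto simp: axis_def)
qed

text \<open>The index set \<open>E\<close> is kept general: the edges of an arbitrary graph index
  themselves, whereas those of a cycle-path wedge are indexed by numbers.\<close>

lemma sym_edge_polytope_eq_signed_hull:
  fixes G :: "'n::finite ugraph"
  assumes "edges G = (\<lambda>e. {p e, q e}) ` E" and "\<And>e. e \<in> E \<Longrightarrow> u e = axis (p e) 1 - axis (q e) 1"
  shows "sym_edge_polytope G = signed_hull u E"
proof -
  have "{axis i 1 - axis j 1 | i j. {i, j} \<in> edges G} = u ` E \<union> (\<lambda>e. - u e) ` E" (is "?L = ?R")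
  proof (intro equalityI subsetI)
    fix x assume "x \<in> ?L"
    then obtain i j where x: "x = axis i 1 - axis j 1" "{i, j} \<in> edges G" by blast
    then obtain e where e: "e \<in> E" "{i, j} = {p e, q e}" using assms(1) by auto
    then have "x = u e \<or> x = - u e" using x(1) assms(2)[OF e(1)] by (auto simp: doubleton_eq_iff)
    then show "x \<in> ?R" using e(1) by blast
  next
    fix x assume "x \<in> ?R"
    then obtain e where e: "e \<in> E" "x = u e \<or> x = - u e" by blast
    have "{p e, q e} \<in> edges G" "{q e, p e} \<in> edges G"
      using e(1) assms(1) by (auto simp: insert_commute)
    moreover have "x = axis (p e) 1 - axis (q e) 1 \<or> x = axis (q e) 1 - axis (p e) 1"
      using e(2) assms(2)[OF e(1)] by auto
    ultimately show "x \<in> ?L" by blast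
  qed
  then show ?thesis by (simp add: sym_edge_polytope_def signed_hull_def)
qed

lemma sym_edge_polytope_oriented:
  assumes "oriented u (edges G)"
  shows "sym_edge_polytope G = signed_hull u (edges G)"
proof -
  have "\<forall>e\<in>edges G. \<exists>pq. e = {fst pq, snd pq} \<and> u e = axis (fst pq) 1 - axis (snd pq) 1"
  proof
    fix e assume "e \<in> edges G"
    then obtain i j where "e = {i, j}" "u e = axis i 1 - axis j 1"
      using orientedE[OF assms] by metis
    then show "\<exists>pq. e = {fst pq, snd pq} \<and> u e = axis (fst pq) 1 - axis (snd pq) 1"
      by (intro exI[of _ "(i, j)"]) simp
  qed
  from bchoice[OF this] obtain h where h: "\<forall>e\<in>edges G. e = {fst (h e), snd (h e)} \<and>
      u e = axis (fst (h e)) 1 - axis (snd (h e)) 1"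
    by blast
  show ?thesis
    by (rule sym_edge_polytope_eq_signed_hull[of _ "fst \<circ> h" "snd \<circ> h"]) (use h in \<open>auto simp: image_iff\<close>)
qed

text \<open>The all-ones vector is orthogonal to \<open>S\<close>, so \<open>axis v 1\<close> lies
  outside the span of \<open>S\<close>; once it is added, every standard basis vector is
  reached.\<close>

lemma dim_edge_vectors:
  fixes S :: "(real ^ 'n::finite) set"
  assumes S: "\<And>x. x \<in> S \<Longrightarrow> \<exists>i j. x = axis i 1 - axis j 1"
    and v: "\<And>i. axis i 1 - axis v 1 \<in> span S"
  shows "dim S + 1 = CARD('n)"
proof -
  let ?one = "(\<chi> i. 1) :: real ^ 'n"
  have one_axis: "?one \<bullet> axis i 1 = 1" for i by (simp add: inner_axis)
  have "span S \<subseteq> {x. ?one \<bullet> x = 0}"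
    by (intro span_minimal subspace_hyperplane) (auto dest!: S simp: inner_diff_right one_axis)
  then have "axis v 1 \<notin> span S" using one_axis by auto
  then have "dim (insert (axis v 1) S) = dim S + 1" by (simp add: dim_insert)
  moreover have "Basis \<subseteq> span (insert (axis v 1) S)"
  proof
    fix b :: "real ^ 'n" assume "b \<in> Basis"
    then obtain i where b: "b = axis i 1" by (auto simp: Basis_vec_def)
    have "(axis i 1 - axis v 1) + axis v 1 \<in> span (insert (axis v 1) S)"
      using v[of i] span_mono[of S "insert (axis v 1) S"] by (intro span_add) (auto intro: span_base)
    then show "b \<in> span (insert (axis v 1) S)" using b by simp
  qed
  then have "span Basis \<subseteq> span (insert (axis v 1) S)"
    by (intro span_minimal) auto
  then have "span (insert (axis v 1) S) = UNIV" by auto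
  then have "dim (insert (axis v 1) S) = DIM(real ^ 'n)" by (metis dim_UNIV dim_span)
  ultimately show ?thesis by simp
qed

section \<open>Walks, integral combinations and the circuit of a unicyclic graph\<close>

text \<open>The edge vectors telescope along a walk, each contributing with coefficient
  \<open>1\<close> or \<open>-1\<close>.\<close>

lemma reachable_imp_int_combination:
  fixes E :: "'n::finite set set"
  assumes u: "oriented u E" and "(a, b) \<in> {(x, y). {x, y} \<in> E}\<^sup>*"
  shows "\<exists>\<mu> :: 'n set \<Rightarrow> int. axis a 1 - axis b 1 = (\<Sum>e\<in>E. of_int (\<mu> e) *\<^sub>R u e)"
  using assms(2)
proof (induction rule: rtrancl_induct)
  case base
  show ?case by (rule exI[of _ "\<lambda>_. 0"]) simp
next
  case (step b c)
  then obtain \<mu> :: "'n set \<Rightarrow> int" where \<mu>: "axis a 1 - axis b 1 = (\<Sum>e\<in>E. of_int (\<mu> e) *\<^sub>R u e)"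
    by blast
  have e: "{b, c} \<in> E" using step by simp
  \<comment> \<open>The sign compares the direction of the walk with the orientation of the
    edge.\<close>
  obtain \<sigma> :: int where \<sigma>: "axis b 1 - axis c 1 = of_int \<sigma> *\<^sub>R u {b, c}"
  proof (cases "u {b, c} = axis b 1 - axis c 1")
    case True
    then show ?thesis using that[of 1] by simp
  next
    case False
    then show ?thesis using that[of "-1"] oriented_doubleton(2)[OF u e] by simp
  qed
  have "(\<Sum>e\<in>E. of_int (\<mu> e + (if e = {b, c} then \<sigma> else 0)) *\<^sub>R u e)
      = (\<Sum>e\<in>E. of_int (\<mu> e) *\<^sub>R u e + (if e = {b, c} then of_int \<sigma> *\<^sub>R u e else 0))"
    by (intro sum.cong) (auto simp: scaleR_add_left)
  also have "\<dots> = (axis a 1 - axis b 1) + (axis b 1 - axis c 1)"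
    using e by (simp add: sum.distrib \<mu> \<sigma>)
  finally have "axis a 1 - axis c 1 = (\<Sum>e\<in>E. of_int (\<mu> e + (if e = {b, c} then \<sigma> else 0)) *\<^sub>R u e)"
    by simp
  then show ?case by (rule exI[of _ "\<lambda>e. \<mu> e + (if e = {b, c} then \<sigma> else 0)"])
qed

text \<open>The indicator of the vertices reachable from \<open>b\<close> is constant along edges.
  As a functional it kills the span, so it takes the same value at \<open>a\<close> as at
  \<open>b\<close>.\<close>

lemma edge_vector_in_span_imp_reachable:
  fixes E :: "'n::finite set set"
  assumes u: "oriented u E" and ab: "axis a 1 - axis b 1 \<in> span (u ` E)"
  shows "(b, a) \<in> {(x, y). {x, y} \<in> E}\<^sup>*"
proof -
  let ?R = "{(x, y). {x, y} \<in> E}"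
  define f :: "real ^ 'n" where "f = (\<chi> i. of_bool ((b, i) \<in> ?R\<^sup>*))"
  have f_axis: "f \<bullet> axis i 1 = of_bool ((b, i) \<in> ?R\<^sup>*)" for i by (simp add: f_def inner_axis)
  have "f \<bullet> u e = 0" if "e \<in> E" for e
  proof -
    obtain i j where ij: "e = {i, j}" "u e = axis i 1 - axis j 1"
      using orientedE[OF u \<open>e \<in> E\<close>] by metis
    have "(i, j) \<in> ?R" "(j, i) \<in> ?R" using ij(1) that by (auto simp: insert_commute)
    then have "(b, i) \<in> ?R\<^sup>* \<longleftrightarrow> (b, j) \<in> ?R\<^sup>*" by (meson rtrancl.rtrancl_into_rtrancl)
    then show ?thesis using ij(2) by (simp add: inner_diff_right f_axis)
  qed
  then have "span (u ` E) \<subseteq> {x. f \<bullet> x = 0}"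
    by (intro span_minimal subspace_hyperplane) auto
  then have "f \<bullet> axis a 1 = f \<bullet> axis b 1" using ab by (auto simp: inner_diff_right)
  then show ?thesis by (simp add: f_axis)
qed

lemma dim_connected_graph:
  fixes G :: "'n::finite ugraph"
  assumes u: "oriented u (edges G)" and "connected_graph G" "verts G = UNIV"
  shows "dim (u ` edges G) + 1 = CARD('n)"
proof (rule dim_edge_vectors)
  fix x assume "x \<in> u ` edges G"
  then obtain e where "e \<in> edges G" "x = u e" by blast
  then show "\<exists>i j. x = axis i 1 - axis j 1" using orientedE[OF u] by metis
next
  fix i :: 'n
  \<comment> \<open>\<open>undefined\<close> serves as an arbitrary root vertex.\<close>
  have "(i, undefined) \<in> {(a, b). {a, b} \<in> edges G}\<^sup>*"
    using assms(2,3) by (simp add: connected_graph_def)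
  then obtain \<mu> :: "'n set \<Rightarrow> int" where
    "axis i 1 - axis undefined 1 = (\<Sum>e\<in>edges G. of_int (\<mu> e) *\<^sub>R u e)"
    using reachable_imp_int_combination[OF u] by blast
  then show "axis i 1 - axis undefined 1 \<in> span (u ` edges G)"
    by (simp only:) (intro span_sum span_scale span_base imageI)
qed

text \<open>An edge occurring in a linear relation between the edge vectors is joined by a walk through the
  remaining edges, which form a basis; hence its vector is an integral combination of that basis.\<close>

lemma dependency_ratio_Ints:
  fixes G :: "'n::finite ugraph"
  assumes u: "oriented u (edges G)" and card: "card (edges G) \<le> dim (u ` edges G) + 1"
    and rel: "(\<Sum>e\<in>edges G. r e *\<^sub>R u e) = 0"
    and e0: "e0 \<in> edges G" "r e0 \<noteq> 0" and e: "e \<in> edges G"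
  shows "r e / r e0 \<in> \<int>"
proof (cases "e = e0")
  case False
  let ?E = "edges G - {e0}"
  have uE: "oriented u ?E" by (rule oriented_subset[OF _ u]) blast
  have "r e0 *\<^sub>R u e0 + (\<Sum>e\<in>?E. r e *\<^sub>R u e) = 0"
    using rel by (simp add: sum.remove[OF _ e0(1)])
  then have "r e0 *\<^sub>R u e0 = - (\<Sum>e\<in>?E. r e *\<^sub>R u e)" by (simp add: eq_neg_iff_add_eq_0)
  then have "(1 / r e0) *\<^sub>R (r e0 *\<^sub>R u e0) = (1 / r e0) *\<^sub>R (- (\<Sum>e\<in>?E. r e *\<^sub>R u e))" by simp
  then have ue0: "u e0 = - (\<Sum>e\<in>?E. (r e / r e0) *\<^sub>R u e)"
    using e0(2) by (simp add: scaleR_sum_right)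
  then have in_span: "u e0 \<in> span (u ` ?E)"
    by (simp only:) (intro span_neg span_sum span_scale span_base imageI)
  obtain a b where ab: "u e0 = axis a 1 - axis b 1" using u e0(1) by (elim orientedE)
  have "(b, a) \<in> {(x, y). {x, y} \<in> ?E}\<^sup>*"
    using edge_vector_in_span_imp_reachable[OF uE] in_span ab by simp
  then obtain \<mu> :: "'n set \<Rightarrow> int" where \<mu>: "axis b 1 - axis a 1 = (\<Sum>e\<in>?E. of_int (\<mu> e) *\<^sub>R u e)"
    using reachable_imp_int_combination[OF uE] by blast
  \<comment> \<open>Both coefficient families express \<open>- u e0\<close>, one from the relation
    and one from the walk. Independence of the remaining edge vectors makes them equal.\<close>
  have "(\<Sum>e\<in>?E. (r e / r e0 - of_int (\<mu> e)) *\<^sub>R u e) = - u e0 - (axis b 1 - axis a 1)"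
    unfolding \<mu> ue0 by (simp add: scaleR_diff_left sum_subtractf)
  then have zero: "(\<Sum>e\<in>?E. (r e / r e0 - of_int (\<mu> e)) *\<^sub>R u e) = 0" using ab by simp
  have inj: "inj_on u ?E" by (rule oriented_inj_on[OF uE])
  have "u ` edges G \<subseteq> span (u ` ?E)" using in_span by (auto intro: span_base)
  then have "dim (u ` edges G) \<le> dim (u ` ?E)" by (metis dim_span dim_subset)
  moreover have "card (u ` ?E) = card (edges G) - 1"
    using e0(1) by (simp add: card_image[OF inj] card_Diff_singleton)
  ultimately have "card (u ` ?E) \<le> dim (u ` ?E)" using card by simp
  then have indep: "independent (u ` ?E)"
    by (intro card_le_dim_spanning[of _ "u ` ?E"]) (auto intro: span_base)
  define k where "k x = (let e = inv_into ?E u x in r e / r e0 - of_int (\<mu> e))" for x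
  have k: "k (u e) = r e / r e0 - of_int (\<mu> e)" if "e \<in> ?E" for e
    unfolding k_def Let_def by (simp only: inv_into_f_f[OF inj that])
  have "(\<Sum>x\<in>u ` ?E. k x *\<^sub>R x) = (\<Sum>e\<in>?E. k (u e) *\<^sub>R u e)"
    by (simp add: sum.reindex[OF inj])
  also have "\<dots> = 0" using zero k by simp
  finally have "k (u e) = 0"
    using independentD[OF indep _ subset_refl, of k "u e"] e False by simp
  then have "r e / r e0 = of_int (\<mu> e)" using k[of e] e False by simp
  then show ?thesis by simp
qed (use e0 in simp)

text \<open>There is one more edge than the dimension, so a nontrivial relation exists. Ratios of
  its nonzero coefficients are integers in both directions, hence \<open>1\<close> or
  \<open>-1\<close>; absorbing these signs into the orientation leaves the plain sum over the
  support, which is \<open>Z\<close>.\<close>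

lemma unicyclic_circuit:
  fixes G :: "'n::finite ugraph"
  assumes "simple_graph G" "connected_graph G" "verts G = UNIV" "card (edges G) = CARD('n)"
  obtains w Z where "oriented w (edges G)" "Z \<subseteq> edges G" "Z \<noteq> {}" "(\<Sum>e\<in>Z. w e) = 0"
proof -
  let ?E = "edges G"
  obtain u :: "'n set \<Rightarrow> real ^ 'n" where u: "oriented u ?E"
    using oriented_exists[of ?E] assms(1) by (auto simp: simple_graph_def)
  have dim: "dim (u ` ?E) + 1 = CARD('n)" by (rule dim_connected_graph[OF u assms(2,3)])
  have inj: "inj_on u ?E" by (rule oriented_inj_on[OF u])
  have "dim (u ` ?E) < card (u ` ?E)" using dim assms(4) by (simp add: card_image[OF inj])
  then have "dependent (u ` ?E)" using independent_bound_general[of "u ` ?E"] by auto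
  then obtain k where k: "\<exists>v\<in>u ` ?E. k v \<noteq> 0" "(\<Sum>v\<in>u ` ?E. k v *\<^sub>R v) = 0"
    using dependent_finite[of "u ` ?E"] by auto
  define r where "r e = k (u e)" for e
  have rel: "(\<Sum>e\<in>?E. r e *\<^sub>R u e) = 0" using k(2) by (simp add: sum.reindex[OF inj] r_def)
  obtain e0 where e0: "e0 \<in> ?E" "r e0 \<noteq> 0" using k(1) by (auto simp: r_def)
  have ints: "r e / r e' \<in> \<int>" if "e \<in> ?E" "e' \<in> ?E" "r e' \<noteq> 0" for e e'
    using dependency_ratio_Ints[OF u _ rel] that dim assms(4) by simp
  have unit: "r e / r e0 = 1 \<or> r e / r e0 = -1" if "e \<in> ?E" "r e \<noteq> 0" for e
  proof -
    have "r e / r e0 \<in> \<int>" "r e0 / r e \<in> \<int>" using ints that e0 by blast+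
    then obtain x y where xy: "r e / r e0 = of_int x" "r e0 / r e = of_int y"
      by (elim Ints_cases)
    \<comment> \<open>A ratio and its inverse are both integers, so each is a unit of the
      integers.\<close>
    have "(r e / r e0) * (r e0 / r e) = 1" using that e0 by simp
    then have "x * y = 1" unfolding xy by (metis of_int_eq_1_iff of_int_mult)
    then have "x = 1 \<or> x = -1" using zmult_eq_1_iff by blast
    then show ?thesis using xy(1) by auto
  qed
  define Z where "Z = {e \<in> ?E. r e \<noteq> 0}"
  define w where "w e = (if e \<in> Z then (r e / r e0) *\<^sub>R u e else u e)" for e
  have w: "w e = u e \<or> w e = - u e" if "e \<in> ?E" for e
    using unit[OF that] by (auto simp: w_def Z_def)
  have "oriented w ?E"
    unfolding oriented_def
  proof
    fix e assume e: "e \<in> ?E"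
    then obtain i j where ij: "i \<noteq> j" "e = {i, j}" "u e = axis i 1 - axis j 1"
      using u by (elim orientedE)
    show "\<exists>i j. i \<noteq> j \<and> e = {i, j} \<and> w e = axis i 1 - axis j 1"
    proof (cases "w e = u e")
      case False
      then have "w e = axis j 1 - axis i 1" using w[OF e] ij(3) by simp
      then show ?thesis using ij(1,2) by (metis insert_commute)
    qed (use ij in auto)
  qed
  moreover have "(\<Sum>e\<in>Z. w e) = 0"
  proof -
    have "(\<Sum>e\<in>Z. w e) = (\<Sum>e\<in>Z. (r e / r e0) *\<^sub>R u e)" by (simp add: w_def)
    also have "\<dots> = (\<Sum>e\<in>?E. (r e / r e0) *\<^sub>R u e)"
      by (intro sum.mono_neutral_left) (auto simp: Z_def)
    also have "\<dots> = (1 / r e0) *\<^sub>R (\<Sum>e\<in>?E. r e *\<^sub>R u e)" by (simp add: scaleR_sum_right)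
    finally show ?thesis using rel by simp
  qed
  moreover have "Z \<subseteq> ?E" "Z \<noteq> {}" using e0 by (auto simp: Z_def)
  ultimately show ?thesis using that by blast
qed

lemma num_facets_unicyclic:
  fixes G :: "'n::finite ugraph"
  assumes "CARD('n) \<ge> 2" "simple_graph G" "connected_graph G" "verts G = UNIV"
    "card (edges G) = CARD('n)"
  shows "\<exists>m. 1 \<le> m \<and> m \<le> CARD('n) \<and>
    num_facets (sym_edge_polytope G) = cycle_facets m * 2 ^ (CARD('n) - m)"
proof -
  obtain w Z where w: "oriented w (edges G)" and Z: "Z \<subseteq> edges G" "Z \<noteq> {}" "(\<Sum>e\<in>Z. w e) = 0"
    using unicyclic_circuit[OF assms(2-5)] by blast
  have dim: "dim (w ` edges G) + 1 = CARD('n)" by (rule dim_connected_graph[OF w assms(3,4)])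
  have "num_facets (sym_edge_polytope G) = cycle_facets (card Z) * 2 ^ (CARD('n) - card Z)"
    using num_facets_signed_hull_circuit[OF _ Z] dim assms(1,5)
    by (simp add: sym_edge_polytope_oriented[OF w])
  moreover have "1 \<le> card Z" using Z(2) by (simp add: Suc_le_eq card_gt_0_iff)
  moreover have "card Z \<le> CARD('n)" using card_mono[OF _ Z(1)] assms(5) by simp
  ultimately show ?thesis by blast
qed

section \<open>Cycles wedged with paths\<close>

lemma sum_cyclic_shift:
  fixes h :: "nat \<Rightarrow> 'a::comm_monoid_add"
  shows "(\<Sum>i<m. h ((i + 1) mod m)) = (\<Sum>i<m. h i)"
proof (cases m)
  case (Suc k)
  have "(\<Sum>i<k. h ((i + 1) mod Suc k)) = (\<Sum>i<k. h (Suc i))" by (intro sum.cong) auto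
  then show ?thesis unfolding Suc by (subst sum.lessThan_Suc_shift) (simp add: add.commute)
qed simp

lemma num_facets_cycle_path_wedge:
  fixes C :: "'n::finite ugraph"
  assumes C: "is_cycle_path_wedge CARD('n) m C"
  shows "num_facets (sym_edge_polytope C) = cycle_facets m * 2 ^ (CARD('n) - m)"
proof -
  let ?n = "CARD('n)"
  have m: "3 \<le> m" "m \<le> ?n" and wedge: "is_wedge (cycle_graph m) (path_graph (?n - m)) C"
    using C by (auto simp: is_cycle_path_wedge_def)
  from wedge obtain f g x y where "x \<in> verts (cycle_graph m)" "y \<in> verts (path_graph (?n - m))"
    and fg: "f x = g y"
    and V: "verts C = f ` verts (cycle_graph m) \<union> g ` verts (path_graph (?n - m))"
    and E: "edges C = (\<lambda>e. f ` e) ` edges (cycle_graph m) \<union> (\<lambda>e. g ` e) ` edges (path_graph (?n - m))"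
    unfolding is_wedge_def by (elim exE bexE conjE) (rule that)
  then have xy: "x < m" "y \<le> ?n - m" by (auto simp: cycle_graph_def path_graph_def)
  \<comment> \<open>Indices below \<open>m\<close> number the cycle edges and the others the path
    edges; \<open>p\<close> and \<open>q\<close> are the two ends. Orienting the cycle edges all the
    way round makes their vectors sum to zero.\<close>
  define p where "p i = (if i < m then f i else g (i - m))" for i
  define q where "q i = (if i < m then f ((i + 1) mod m) else g (i - m + 1))" for i
  define u :: "nat \<Rightarrow> real ^ 'n" where "u i = axis (p i) 1 - axis (q i) 1" for i
  have cyc: "edges (cycle_graph m) = (\<lambda>i. {i, (i + 1) mod m}) ` {..<m}"
    and pth: "edges (path_graph l) = (\<lambda>i. {i, i + 1}) ` {..<l}" for l
    by (auto simp: cycle_graph_def path_graph_def)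
  have "{..<?n} = {..<m} \<union> (\<lambda>j. m + j) ` {..<?n - m}"
  proof (intro equalityI subsetI)
    fix i assume "i \<in> {..<?n}"
    then show "i \<in> {..<m} \<union> (\<lambda>j. m + j) ` {..<?n - m}"
      by (cases "i < m") (auto simp: image_iff intro!: bexI[of _ "i - m"])
  qed (use m in auto)
  then have "(\<lambda>i. {p i, q i}) ` {..<?n} =
      (\<lambda>i. {p i, q i}) ` {..<m} \<union> (\<lambda>j. {p (m + j), q (m + j)}) ` {..<?n - m}"
    by (simp add: image_Un image_image)
  also have "(\<lambda>i. {p i, q i}) ` {..<m} = (\<lambda>e. f ` e) ` edges (cycle_graph m)"
    unfolding cyc image_image by (intro image_cong) (auto simp: p_def q_def)
  also have "(\<lambda>j. {p (m + j), q (m + j)}) ` {..<?n - m} = (\<lambda>e. g ` e) ` edges (path_graph (?n - m))"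
    unfolding pth image_image by (intro image_cong) (auto simp: p_def q_def)
  finally have edges: "edges C = (\<lambda>i. {p i, q i}) ` {..<?n}" using E by simp
  have P: "sym_edge_polytope C = signed_hull u {..<?n}"
    by (rule sym_edge_polytope_eq_signed_hull[OF edges]) (simp add: u_def)
  have "(\<Sum>i<m. u i) = (\<Sum>i<m. axis (f i) 1) - (\<Sum>i<m. axis (f ((i + 1) mod m)) 1)"
    by (simp add: u_def p_def q_def sum_subtractf)
  then have rel: "(\<Sum>i<m. u i) = 0"
    using sum_cyclic_shift[of "\<lambda>i. axis (f i) 1 :: real ^ 'n" m] by simp
  let ?S = "span (u ` {..<?n})"
  have u_in: "u i \<in> ?S" if "i < ?n" for i using that by (intro span_base) auto
  have f_in: "axis (f i) 1 - axis (f 0) 1 \<in> ?S" if "i < m" for i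
    using that
  proof (induction i)
    case (Suc i)
    have "(axis (f i) 1 - axis (f 0) 1) - u i \<in> ?S"
      by (rule span_diff; use Suc m in \<open>auto intro: u_in\<close>)
    then show ?case using Suc.prems by (simp add: u_def p_def q_def)
  qed (simp add: span_zero)
  have g_in: "axis (g j) 1 - axis (g 0) 1 \<in> ?S" if "j \<le> ?n - m" for j
    using that
  proof (induction j)
    case (Suc j)
    have "(axis (g j) 1 - axis (g 0) 1) - u (m + j) \<in> ?S"
      by (rule span_diff; use Suc m in \<open>auto intro: u_in\<close>)
    then show ?case by (simp add: u_def p_def q_def)
  qed (simp add: span_zero)
  have "axis v 1 - axis (f 0) 1 \<in> ?S" for v
  proof -
    have "v \<in> verts C" using is_cycle_path_wedge_verts[OF C] by simp
    then consider i where "i < m" "v = f i" | j where "j \<le> ?n - m" "v = g j"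
      unfolding V by (auto simp: cycle_graph_def path_graph_def)
    then show ?thesis
    proof cases
      case 2
      \<comment> \<open>A path vertex is joined to \<open>f 0\<close> through the identified vertex
        \<open>g y = f x\<close>, which may be any vertex of the path and of the cycle.\<close>
      have "(axis (g j) 1 - axis (g 0) 1) - (axis (g y) 1 - axis (g 0) 1)
          + (axis (f x) 1 - axis (f 0) 1) \<in> ?S"
        by (rule span_add, rule span_diff; use 2 xy in \<open>auto intro: f_in g_in\<close>)
      then show ?thesis using 2 fg by simp
    qed (use f_in in auto)
  qed
  then have dim: "dim (u ` {..<?n}) + 1 = ?n"
    by (intro dim_edge_vectors[of _ "f 0"]) (auto simp: u_def)
  have "num_facets (signed_hull u {..<?n}) =
      cycle_facets (card {..<m}) * 2 ^ (card {..<?n} - card {..<m})"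
    by (rule num_facets_signed_hull_circuit) (use m rel dim in \<open>auto simp: lessThan_empty_iff\<close>)
  then show ?thesis using P by simp
qed

section \<open>Comparing the counts for different cycle lengths\<close>

text \<open>Absorption is applied twice, with the symmetry of binomials in between. The central
  binomial on the left occurs in the counts for \<open>2 * k + 2\<close> and
  \<open>2 * k + 3\<close>, so both can be compared with the count for
  \<open>2 * k + 1\<close>.\<close>

lemma central_binomial_Suc:
  "(k + 1) * ((2 * k + 2) choose (k + 1)) = 2 * cycle_facets (2 * k + 1)"
proof -
  have "(k + 1) * ((2 * k + 2) choose (k + 1)) = (2 * k + 2) * ((2 * k + 1) choose k)"
    using Suc_times_binomial[of k "2 * k + 1"] by simp
  also have "(2 * k + 1) choose k = (2 * k + 1) choose (k + 1)"
    using binomial_symmetric[of k "2 * k + 1"] by simp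
  also have "(2 * k + 2) * \<dots> = 2 * ((k + 1) * ((2 * k + 1) choose (k + 1)))" by simp
  also have "(k + 1) * ((2 * k + 1) choose (k + 1)) = (2 * k + 1) * (2 * k choose k)"
    using Suc_times_binomial[of k "2 * k"] by simp
  finally show ?thesis by (simp add: cycle_facets_def)
qed

lemma cycle_facets_even_le: "cycle_facets (2 * k + 2) \<le> 2 * cycle_facets (2 * k + 1)"
proof -
  have "cycle_facets (2 * k + 2) \<le> (k + 1) * ((2 * k + 2) choose (k + 1))"
    by (simp add: cycle_facets_def)
  then show ?thesis by (simp only: central_binomial_Suc)
qed

text \<open>The ratio of the two counts is \<open>(4 * k + 6) / (k + 1)\<close>, which exceeds
  \<open>4\<close>, the factor lost when two edges outside the cycle move into it.\<close>

lemma cycle_facets_odd_step: "4 * cycle_facets (2 * k + 1) \<le> cycle_facets (2 * (k + 1) + 1)"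
proof -
  have "(k + 1) * cycle_facets (2 * (k + 1) + 1) = (2 * k + 3) * ((k + 1) * ((2 * k + 2) choose (k + 1)))"
    by (simp add: cycle_facets_def algebra_simps del: binomial_Suc_Suc)
  also have "\<dots> = (4 * k + 6) * cycle_facets (2 * k + 1)"
    by (simp only: central_binomial_Suc) simp
  also have "\<dots> \<ge> (4 * k + 4) * cycle_facets (2 * k + 1)" by (intro mult_right_mono) auto
  finally have "(k + 1) * (4 * cycle_facets (2 * k + 1)) \<le> (k + 1) * cycle_facets (2 * (k + 1) + 1)"
    by (simp add: algebra_simps)
  then show ?thesis by (simp only: mult_le_cancel1)
qed

lemma cycle_facets_odd_mono:
  "cycle_facets (2 * k + 1) * 4 ^ d \<le> cycle_facets (2 * (k + d) + 1)"
proof (induction d)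
  case (Suc d)
  then show ?case using cycle_facets_odd_step[of "k + d"] by simp
qed simp

lemma cycle_facets_le_odd:
  assumes "1 \<le> m" "m \<le> n" "odd M" "M \<le> n" "n \<le> M + 1"
  shows "cycle_facets m * 2 ^ (n - m) \<le> cycle_facets M * 2 ^ (n - M)"
proof -
  obtain K where K: "M = 2 * K + 1" using \<open>odd M\<close> by (elim oddE)
  \<comment> \<open>\<open>2 * k + 1\<close> is the largest odd number up to \<open>m\<close>. An
    even \<open>m\<close> is first lowered to it, at the gain of one factor \<open>2\<close>; steps
    of two then lead up to \<open>M\<close>, the largest odd number up to \<open>n\<close>.\<close>
  define k where "k = (m - 1) div 2"
  have k: "k \<le> K" "2 * k + 1 \<le> n" using assms K by (auto simp: k_def)
  have "cycle_facets m * 2 ^ (n - m) \<le> cycle_facets (2 * k + 1) * 2 ^ (n - (2 * k + 1))"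
  proof (cases "odd m")
    case True
    then have "m = 2 * k + 1" unfolding k_def by presburger
    then show ?thesis by simp
  next
    case False
    then have mk: "m = 2 * k + 2" using assms(1) unfolding k_def by presburger
    then have "n - (2 * k + 1) = Suc (n - m)" using assms(2) by simp
    then show ?thesis using cycle_facets_even_le[of k] mk by simp
  qed
  also have "n - (2 * k + 1) = 2 * (K - k) + (n - M)" using k K assms by simp
  then have "cycle_facets (2 * k + 1) * 2 ^ (n - (2 * k + 1))
      = cycle_facets (2 * k + 1) * 4 ^ (K - k) * 2 ^ (n - M)"
    by (simp add: power_add power_mult)
  also have "\<dots> \<le> cycle_facets M * 2 ^ (n - M)"
    using cycle_facets_odd_mono[of k "K - k"] k(1) K by simp
  finally show ?thesis .
qed

theorem theorem3p2:
  fixes G :: "'n::finite ugraph" and n :: nat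
  assumes "CARD('n) = n" and "n \<ge> 3"
    and "simple_graph G" and "connected_graph G"
    and "verts G = UNIV" and "card (edges G) = n"
  shows "(odd n \<longrightarrow> (\<forall>C :: 'n ugraph. is_cycle_path_wedge n n C \<longrightarrow>
            num_facets (sym_edge_polytope G) \<le> num_facets (sym_edge_polytope C))) \<and>
         (even n \<longrightarrow> (\<forall>C :: 'n ugraph. is_cycle_path_wedge n (n - 1) C \<longrightarrow>
            num_facets (sym_edge_polytope G) \<le> num_facets (sym_edge_polytope C)))"
proof -
  obtain m where m: "1 \<le> m" "m \<le> n"
    "num_facets (sym_edge_polytope G) = cycle_facets m * 2 ^ (n - m)"
    using num_facets_unicyclic[of G] assms by auto
  have C: "num_facets (sym_edge_polytope C) = cycle_facets M * 2 ^ (n - M)"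
    if "is_cycle_path_wedge n M C" for C :: "'n ugraph" and M
    using num_facets_cycle_path_wedge[of M C] that assms(1) by simp
  show ?thesis
  \<comment> \<open>Each parity uses the largest odd number up to \<open>n\<close>: \<open>n\<close>
    itself or \<open>n - 1\<close>.\<close>
  proof (intro conjI impI allI)
    fix C :: "'n ugraph"
    assume "odd n" "is_cycle_path_wedge n n C"
    then show "num_facets (sym_edge_polytope G) \<le> num_facets (sym_edge_polytope C)"
      using cycle_facets_le_odd[of m n n] m C by simp
  next
    fix C :: "'n ugraph"
    assume "even n" "is_cycle_path_wedge n (n - 1) C"
    then show "num_facets (sym_edge_polytope G) \<le> num_facets (sym_edge_polytope C)"
      using cycle_facets_le_odd[of m n "n - 1"] m C assms(2) by simp
  qed
qed

end
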